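(* Let $N\ge2$. For any vector $\boldsymbol{x}\in(\mathbb{R}\setminus\{0\})^N$, the maps $f_{\boldsymbol{x}}(M)=\mathrm{diag}(\boldsymbol{x})\,M$ and $g_{\boldsymbol{x}}(M)=M\,\mathrm{diag}(\boldsymbol{x})$ are permutations of $\mathcal{C}^N$; that is, each maps $\mathcal{C}^N$ bijectively onto itself.
   Context: The set $\mathcal{C}_L^N$ of L-CoLT (lower-collinear triangular) matrices consists of all $M=[m_{i,j}]\in\mathbb{R}^{N\times N}$ with $m_{i,j}=0$ for $i<j$ such that there is a vector $\boldsymbol{r}\in(\mathbb{R}\setminus\{0\})^{N-1}$ with $m_{i+1,j}/m_{i,j}=r_i$ for all $1\le j\le i\le N-1$ (in particular the denominators are nonzero). The set $\mathcal{C}_U^N$ of U-CoLT (upper-collinear triangular) matrices consists of all $M=[m_{i,j}]\in\mathbb{R}^{N\times N}$ with $m_{i,j}=0$ for $i\ge j$ such that there is a vector $\boldsymbol{r}'\in(\mathbb{R}\setminus\{0\})^{N-2}$ with $m_{i-1,j}/m_{i,j}=r'_{i-1}$ for all $2\le i<j\le N$ (in particular the denominators are nonzero). $\mathcal{C}^N=\mathcal{C}_L^N+\mathcal{C}_U^N=\{A+B : A\in\mathcal{C}_L^N,\ B\in\mathcal{C}_U^N\}$. $\mathrm{diag}(\boldsymbol{x})$ is the diagonal matrix with diagonal $\boldsymbol{x}$. *)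

theory Defs
  imports Complex_Main "Jordan_Normal_Form.Matrix"
begin

(* Rows, columns and vector entries are counted from 0, so the index i here is i + 1 in the usual
   notation. Division by 0 is 0 in HOL; hence the explicit condition that denominators are
   nonzero. *)

(* Entry (N - 1, N - 1) occurs in no ratio and is unconstrained, in particular it may be 0. *)
definition L_CoLT :: "nat \<Rightarrow> real mat set" where
  "L_CoLT N = {M \<in> carrier_mat N N.
     (\<forall>i<N. \<forall>j<N. i < j \<longrightarrow> M $$ (i, j) = 0) \<and>
     (\<exists>r \<in> carrier_vec (N - 1). (\<forall>i < N - 1. r $ i \<noteq> 0) \<and>
       (\<forall>i j. j \<le> i \<and> i < N - 1 \<longrightarrow>
          M $$ (i, j) \<noteq> 0 \<and> M $$ (i + 1, j) / M $$ (i, j) = r $ i))}"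

(* The ratio in column j is taken between rows i and i + 1, both strictly above the diagonal.
   Entry (0, 1) occurs in no ratio and is unconstrained, in particular it may be 0. *)
definition U_CoLT :: "nat \<Rightarrow> real mat set" where
  "U_CoLT N = {M \<in> carrier_mat N N.
     (\<forall>i<N. \<forall>j<N. i \<ge> j \<longrightarrow> M $$ (i, j) = 0) \<and>
     (\<exists>r' \<in> carrier_vec (N - 2). (\<forall>i < N - 2. r' $ i \<noteq> 0) \<and>
       (\<forall>i j. i + 1 < j \<and> j < N \<longrightarrow>
          M $$ (i + 1, j) \<noteq> 0 \<and> M $$ (i, j) / M $$ (i + 1, j) = r' $ i))}"

definition CoLT :: "nat \<Rightarrow> real mat set" where
  "CoLT N = {A + B | A B. A \<in> L_CoLT N \<and> B \<in> U_CoLT N}"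

definition diag_of_vec :: "real vec \<Rightarrow> real mat" where
  "diag_of_vec x = mat_diag (dim_vec x) (\<lambda>i. x $ i)"

end

theory Submission
  imports Defs
begin

text \<open>Multiplying entry \<open>(i, j)\<close> by \<open>a i * b j\<close> turns the ratio of consecutive entries
  of a column into \<open>a (i + 1) / a i\<close> times the old one, which still does not depend on the column.
  So such a scaling preserves both classes of collinear triangular matrices, and it is inverted by
  the scaling with the reciprocals.\<close>

definition scale_mat :: "nat \<Rightarrow> (nat \<Rightarrow> real) \<Rightarrow> (nat \<Rightarrow> real) \<Rightarrow> real mat \<Rightarrow> real mat" where
  "scale_mat N a b M = mat N N (\<lambda>(i, j). a i * M $$ (i, j) * b j)"

lemma scale_mat_carrier [simp]: "scale_mat N a b M \<in> carrier_mat N N"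
  by (simp add: scale_mat_def)

lemma scale_mat_index [simp]:
  "i < N \<Longrightarrow> j < N \<Longrightarrow> scale_mat N a b M $$ (i, j) = a i * M $$ (i, j) * b j"
  by (simp add: scale_mat_def)

lemma scale_mat_add:
  assumes "A \<in> carrier_mat N N" "B \<in> carrier_mat N N"
  shows "scale_mat N a b (A + B) = scale_mat N a b A + scale_mat N a b B"
  using assms by (intro eq_matI) (auto simp: scale_mat_def algebra_simps)

lemma scale_mat_inverse:
  assumes "M \<in> carrier_mat N N"
    and "\<And>i. i < N \<Longrightarrow> a i * a' i = 1" and "\<And>j. j < N \<Longrightarrow> b j * b' j = 1"
  shows "scale_mat N a b (scale_mat N a' b' M) = M"
proof (rule eq_matI)
  fix i j assume "i < dim_row M" "j < dim_col M"
  then have ij: "i < N" "j < N" using assms(1) by auto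
  have "a i * (a' i * M $$ (i, j) * b' j) * b j = (a i * a' i) * M $$ (i, j) * (b j * b' j)"
    by (simp add: algebra_simps)
  then show "scale_mat N a b (scale_mat N a' b' M) $$ (i, j) = M $$ (i, j)"
    using ij assms(2,3) by simp
qed (use assms(1) in \<open>auto simp: scale_mat_def\<close>)

lemma scale_mat_L_CoLT:
  assumes M: "M \<in> L_CoLT N"
    and a: "\<And>i. i < N \<Longrightarrow> a i \<noteq> 0" and b: "\<And>j. j < N \<Longrightarrow> b j \<noteq> 0"
  shows "scale_mat N a b M \<in> L_CoLT N"
proof -
  obtain r where r: "r \<in> carrier_vec (N - 1)" "\<forall>i < N - 1. r $ i \<noteq> 0"
    and "\<forall>i j. j \<le> i \<and> i < N - 1 \<longrightarrow>
      M $$ (i, j) \<noteq> 0 \<and> M $$ (i + 1, j) / M $$ (i, j) = r $ i"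
    using M unfolding L_CoLT_def mem_Collect_eq by (elim conjE bexE) (rule that)
  then have ratio: "M $$ (i, j) \<noteq> 0 \<and> M $$ (i + 1, j) / M $$ (i, j) = r $ i"
    if "j \<le> i" "i < N - 1" for i j
    using that by blast
  define s where "s = vec (N - 1) (\<lambda>i. a (i + 1) / a i * r $ i)"
  have zero: "\<forall>i<N. \<forall>j<N. i < j \<longrightarrow> scale_mat N a b M $$ (i, j) = 0"
    using M by (simp add: L_CoLT_def)
  have nz: "\<forall>i<N - 1. s $ i \<noteq> 0"
    using r(2) a by (simp add: s_def)
  have rat: "scale_mat N a b M $$ (i, j) \<noteq> 0 \<and>
      scale_mat N a b M $$ (i + 1, j) / scale_mat N a b M $$ (i, j) = s $ i"
    if "j \<le> i" "i < N - 1" for i j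
  proof -
    have lt: "i < N" "i + 1 < N" "j < N" using that by auto
    show ?thesis
      using lt that a[OF lt(1)] b[OF lt(3)] conjunct1[OF ratio[OF that]]
        conjunct2[OF ratio[OF that], symmetric]
      by (simp add: s_def)
  qed
  have "s \<in> carrier_vec (N - 1)" by (simp add: s_def)
  then show ?thesis
    unfolding L_CoLT_def using zero nz rat
    by (intro CollectI conjI bexI[of _ s] scale_mat_carrier) blast+
qed

lemma scale_mat_U_CoLT:
  assumes M: "M \<in> U_CoLT N"
    and a: "\<And>i. i < N \<Longrightarrow> a i \<noteq> 0" and b: "\<And>j. j < N \<Longrightarrow> b j \<noteq> 0"
  shows "scale_mat N a b M \<in> U_CoLT N"
proof -
  obtain r where r: "r \<in> carrier_vec (N - 2)" "\<And>i. i < N - 2 \<Longrightarrow> r $ i \<noteq> 0"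
    and ratio: "\<And>i j. i + 1 < j \<Longrightarrow> j < N \<Longrightarrow>
      M $$ (i + 1, j) \<noteq> 0 \<and> M $$ (i, j) / M $$ (i + 1, j) = r $ i"
    using M unfolding U_CoLT_def by blast
  define s where "s = vec (N - 2) (\<lambda>i. a i / a (i + 1) * r $ i)"
  have zero: "\<forall>i<N. \<forall>j<N. i \<ge> j \<longrightarrow> scale_mat N a b M $$ (i, j) = 0"
    using M by (simp add: U_CoLT_def)
  have nz: "\<forall>i<N - 2. s $ i \<noteq> 0"
    using r(2) a by (simp add: s_def)
  have rat: "scale_mat N a b M $$ (i + 1, j) \<noteq> 0 \<and>
      scale_mat N a b M $$ (i, j) / scale_mat N a b M $$ (i + 1, j) = s $ i"
    if "i + 1 < j" "j < N" for i j
  proof -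
    have lt: "i < N" "i + 1 < N" "i < N - 2" using that by auto
    show ?thesis
      using lt that a[OF lt(2)] b[OF that(2)] conjunct1[OF ratio[OF that]]
        conjunct2[OF ratio[OF that], symmetric]
      by (simp add: s_def)
  qed
  have "s \<in> carrier_vec (N - 2)" by (simp add: s_def)
  then show ?thesis
    unfolding U_CoLT_def using zero nz rat
    by (intro CollectI conjI bexI[of _ s] scale_mat_carrier) blast+
qed

lemma CoLT_carrier: "M \<in> CoLT N \<Longrightarrow> M \<in> carrier_mat N N"
  by (auto simp: CoLT_def L_CoLT_def U_CoLT_def)

lemma scale_mat_CoLT:
  assumes "M \<in> CoLT N"
    and "\<And>i. i < N \<Longrightarrow> a i \<noteq> 0" and "\<And>j. j < N \<Longrightarrow> b j \<noteq> 0"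
  shows "scale_mat N a b M \<in> CoLT N"
proof -
  obtain A B where AB: "A \<in> L_CoLT N" "B \<in> U_CoLT N" "M = A + B"
    using assms(1) by (auto simp: CoLT_def)
  then have "scale_mat N a b M = scale_mat N a b A + scale_mat N a b B"
    by (auto intro!: scale_mat_add simp: L_CoLT_def U_CoLT_def)
  then show ?thesis
    using scale_mat_L_CoLT[OF AB(1)] scale_mat_U_CoLT[OF AB(2)] assms(2,3)
    unfolding CoLT_def by blast
qed

lemma bij_betw_scale_mat_CoLT:
  assumes "\<And>i. i < N \<Longrightarrow> a i \<noteq> 0" and "\<And>j. j < N \<Longrightarrow> b j \<noteq> 0"
  shows "bij_betw (scale_mat N a b) (CoLT N) (CoLT N)"
  by (rule bij_betw_byWitness[where f' = "scale_mat N (\<lambda>i. 1 / a i) (\<lambda>j. 1 / b j)"])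
    (use assms in \<open>auto intro!: scale_mat_inverse scale_mat_CoLT CoLT_carrier\<close>)

lemma diag_of_vec_mult_left:
  assumes "x \<in> carrier_vec N" "M \<in> carrier_mat N N"
  shows "diag_of_vec x * M = scale_mat N (\<lambda>i. x $ i) (\<lambda>_. 1) M"
  using assms by (simp add: diag_of_vec_def scale_mat_def mat_diag_mult_left)

lemma diag_of_vec_mult_right:
  assumes "x \<in> carrier_vec N" "M \<in> carrier_mat N N"
  shows "M * diag_of_vec x = scale_mat N (\<lambda>_. 1) (\<lambda>j. x $ j) M"
  using assms by (simp add: diag_of_vec_def scale_mat_def mat_diag_mult_right)

theorem corollary3p7:
  fixes N :: nat and x :: "real vec"
  assumes "N \<ge> 2"
    and "x \<in> carrier_vec N"
    and "\<forall>i<N. x $ i \<noteq> 0"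
  shows "bij_betw (\<lambda>M. diag_of_vec x * M) (CoLT N) (CoLT N)
       \<and> bij_betw (\<lambda>M. M * diag_of_vec x) (CoLT N) (CoLT N)"
proof
  have "bij_betw (scale_mat N (\<lambda>i. x $ i) (\<lambda>_. 1)) (CoLT N) (CoLT N)"
    using assms(3) by (intro bij_betw_scale_mat_CoLT) auto
  then show "bij_betw (\<lambda>M. diag_of_vec x * M) (CoLT N) (CoLT N)"
    by (rule bij_betw_cong[THEN iffD1, rotated])
      (simp add: diag_of_vec_mult_left[OF assms(2)] CoLT_carrier)
  have "bij_betw (scale_mat N (\<lambda>_. 1) (\<lambda>j. x $ j)) (CoLT N) (CoLT N)"
    using assms(3) by (intro bij_betw_scale_mat_CoLT) auto
  then show "bij_betw (\<lambda>M. M * diag_of_vec x) (CoLT N) (CoLT N)"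
    by (rule bij_betw_cong[THEN iffD1, rotated])
      (simp add: diag_of_vec_mult_right[OF assms(2)] CoLT_carrier)
qed

end
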